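(* Let $M\ge 1$ and let $x_0,\dots,x_{M-1}\in\mathbb{R}$ be $M$ uniform samples over one period, with discrete Fourier coefficients $a_0,\dots,a_{M-1}$, exactly $P\ge 1$ of which are non-zero. Then the minimal number of time delays $L\in\mathbb{N}=\{0,1,2,\dots\}$ for which there exists $\mathbf{K}=(K_0,\dots,K_L)^\top\in\mathbb{R}^{L+1}$ giving a perfect prediction, i.e. satisfying $$x_{(k+1)\bmod M}=\sum_{l=0}^{L}K_l\,x_{(k-l)\bmod M}\qquad\text{for all }k\in\{0,1,\dots,M-1\},$$ is $L=P-1$. Moreover, when $L=P-1$, the solution $\mathbf{K}$ is unique.
   Context: Setting: a real scalar $T$-periodic signal is sampled uniformly at $t_k=kT/M$, $k\in\{0,\dots,M-1\}$, giving $x_k\in\mathbb{R}$. Put $j=\sqrt{-1}$ and $\omega=e^{-j2\pi/M}$. The Fourier coefficients are $a_i=\frac1M\sum_{k=0}^{M-1}x_k e^{j2\pi ki/M}\in\mathbb{C}$, $i\in\{0,\dots,M-1\}$, and the Fourier interpolant is $S_M(t)=\sum_{i=0}^{M-1}a_i e^{-j2\pi it/T}$, so that $x_k=S_M(kT/M)=\sum_{i=0}^{M-1} a_i\omega^{ki}$. Indices of samples are taken modulo $M$ (representatives in $\{0,\dots,M-1\}$). $L=0$ means no delays. *)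

theory Defs
  imports Complex_Main "Jordan_Normal_Form.Matrix"
begin

text \<open>The samples are the values \<open>x 0, \<dots>, x (M - 1)\<close> of a sequence; its other values are irrelevant.
  Following the source, the analysis formula carries the factor \<open>1/M\<close> and the positive exponent.\<close>

definition fourier_coeff :: "nat \<Rightarrow> (nat \<Rightarrow> real) \<Rightarrow> nat \<Rightarrow> complex" where
  "fourier_coeff M x i =
     1 / of_nat M * (\<Sum>k<M. of_real (x k) * exp (\<i> * of_real (2 * pi * real k * real i / real M)))"

text \<open>The index \<open>k - l\<close> is formed in the integers, so that its residue modulo \<open>M\<close> lies in
  \<open>{0, \<dots>, M - 1}\<close> also for \<open>l > k\<close>. The dimension of \<open>K\<close> is constrained separately, by
  \<open>K \<in> carrier_vec (L + 1)\<close>.\<close>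

definition perfect_prediction :: "nat \<Rightarrow> (nat \<Rightarrow> real) \<Rightarrow> nat \<Rightarrow> real vec \<Rightarrow> bool" where
  "perfect_prediction M x L K \<longleftrightarrow>
     (\<forall>k<M. x ((k + 1) mod M) = (\<Sum>l=0..L. K $ l * x (nat ((int k - int l) mod int M))))"

end

theory Submission
  imports Defs "HOL-Computational_Algebra.Polynomial"
begin

text \<open>Put \<open>z i = exp (2 \<pi> \<i> i / M)\<close>. A cyclic shift of the samples multiplies their transform
  by a power of \<open>z i\<close>, so the transform of the prediction error at \<open>i\<close> is \<open>a i\<close> times
  \<open>1 / z i - (\<Sum>l\<le>L. K l * z i ^ l)\<close>, up to the factor \<open>M\<close>. Hence \<open>K\<close> predicts perfectly iff
  \<open>1 - (\<Sum>l\<le>L. K l * Z ^ (l + 1))\<close> vanishes at the \<open>P\<close> distinct points \<open>z i\<close> with \<open>a i \<noteq> 0\<close>.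
  This polynomial is non-zero, so \<open>P \<le> L + 1\<close>; for \<open>L = P - 1\<close> it can only be
  \<open>\<Prod>i. (1 - Z / z i)\<close>. The samples being real, the real part of a complex solution is again
  a solution.\<close>

section \<open>Polynomials with more roots than their degree\<close>

lemma poly_eq_0_if_many_roots:
  fixes p :: "'a::{comm_ring_1,ring_no_zero_divisors} poly"
  assumes "\<And>w. w \<in> A \<Longrightarrow> poly p w = 0" and "degree p < card A"
  shows "p = 0"
proof (rule ccontr)
  assume "p \<noteq> 0"
  have "card A \<le> card {w. poly p w = 0}"
    using assms(1) \<open>p \<noteq> 0\<close> by (intro card_mono poly_roots_finite) auto
  also have "\<dots> \<le> degree p"
    using \<open>p \<noteq> 0\<close> by (rule card_poly_roots_bound)
  finally show False
    using assms(2) by simp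
qed

text \<open>Serves three times: for the injectivity of the transform, for the bound
  \<open>P \<le> L + 1\<close> and for the uniqueness of the solution.\<close>

lemma poly_sum_monom_eq_0_if_many_roots:
  fixes c :: "nat \<Rightarrow> 'a::{comm_ring_1,ring_no_zero_divisors}"
  assumes "\<And>w. w \<in> A \<Longrightarrow> (\<Sum>k<n. c k * w ^ k) = 0" and "n \<le> card A" and "k < n"
  shows "c k = 0"
proof -
  let ?p = "\<Sum>k<n. monom (c k) k"
  have "degree ?p \<le> n - 1"
    by (intro degree_sum_le) (auto intro: order_trans[OF degree_monom_le])
  \<comment> \<open>The hypothesis \<open>k < n\<close> excludes \<open>n = 0\<close>, so
    \<open>n - 1\<close> is strictly below \<open>n\<close>.\<close>
  then have "degree ?p < card A"
    using assms(2,3) by linarith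
  moreover have "poly ?p w = 0" if "w \<in> A" for w
    using assms(1)[OF that] by (simp add: poly_sum poly_monom)
  ultimately have "?p = 0"
    by (intro poly_eq_0_if_many_roots)
  then have "coeff ?p k = 0"
    by simp
  then show ?thesis
    using assms(3) by (simp add: coeff_sum)
qed

section \<open>Cyclic shifts and roots of unity\<close>

lemma power_int_mod_root_of_unity:
  fixes z :: "'a::field"
  assumes "z ^ M = 1" and "M > 0"
  shows "z powi (n mod int M) = z powi n"
proof -
  have "z \<noteq> 0"
    using assms by (auto simp: power_0_left)
  have "z powi n = z powi (int M * (n div int M) + n mod int M)"
    by simp
  also have "\<dots> = (z powi int M) powi (n div int M) * z powi (n mod int M)"
    using \<open>z \<noteq> 0\<close> by (metis power_int_add power_int_mult)
  also have "\<dots> = z powi (n mod int M)"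
    using assms(1) by simp
  finally show ?thesis ..
qed

text \<open>Reindexing by the inverse shift replaces \<open>z ^ k\<close> by
  \<open>z powi (k - s)\<close>; reducing the index modulo \<open>M\<close> is harmless because
  \<open>z ^ M = 1\<close>. An integer \<open>s\<close> covers both the advance \<open>s = 1\<close>
  and the delays \<open>s = - l\<close>.\<close>

lemma sum_cyclic_shift:
  fixes z :: "'a::field" and y :: "nat \<Rightarrow> 'a"
  assumes "z ^ M = 1" and "M > 0"
  shows "(\<Sum>k<M. y (nat ((int k + s) mod int M)) * z ^ k) = z powi (- s) * (\<Sum>k<M. y k * z ^ k)"
proof -
  have "z \<noteq> 0"
    using assms by (auto simp: power_0_left)
  have "(\<Sum>k<M. y (nat ((int k + s) mod int M)) * z ^ k) = (\<Sum>k<M. y k * z powi (int k - s))"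
  proof (rule sum.reindex_bij_witness[of _ "\<lambda>k. nat ((int k - s) mod int M)"
        "\<lambda>k. nat ((int k + s) mod int M)"])
    fix k
    assume "k \<in> {..<M}"
    have "z powi (int (nat ((int k + s) mod int M)) - s)
        = z powi ((int (nat ((int k + s) mod int M)) - s) mod int M)"
      using assms by (simp add: power_int_mod_root_of_unity)
    also have "\<dots> = z ^ k"
      using \<open>k \<in> {..<M}\<close> by (simp add: mod_simps)
    finally show "y (nat ((int k + s) mod int M)) * z powi (int (nat ((int k + s) mod int M)) - s)
        = y (nat ((int k + s) mod int M)) * z ^ k"
      by simp
  qed (use assms in \<open>auto simp: mod_simps nat_less_iff\<close>)
  also have "\<dots> = z powi (- s) * (\<Sum>k<M. y k * z ^ k)"
    using \<open>z \<noteq> 0\<close> by (simp add: sum_distrib_left power_int_diff power_int_minus field_simps)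
  finally show ?thesis .
qed

section \<open>Fourier nodes and the support of the transform\<close>

definition fourier_node :: "nat \<Rightarrow> nat \<Rightarrow> complex" where
  "fourier_node M i = cis (2 * pi * real i / real M)"

definition fourier_support :: "nat \<Rightarrow> (nat \<Rightarrow> real) \<Rightarrow> nat set" where
  "fourier_support M x = {i. i < M \<and> fourier_coeff M x i \<noteq> 0}"

lemma fourier_node_nonzero [simp]: "fourier_node M i \<noteq> 0"
  by (simp add: fourier_node_def)

lemma fourier_node_power_order: "M > 0 \<Longrightarrow> fourier_node M i ^ M = 1"
  by (simp add: fourier_node_def DeMoivre cis_multiple_2pi)

lemma inj_on_fourier_node: "inj_on (fourier_node M) {..<M}"
proof (cases "M = 0")
  case False
  then show ?thesis
    using bij_betw_roots_unity[of M] by (simp add: fourier_node_def[abs_def] bij_betw_def)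
qed simp

text \<open>Presents the coefficients as values, up to \<open>1/M\<close>, of one polynomial whose
  coefficients are the samples.\<close>

lemma fourier_coeff_eq:
  "fourier_coeff M x i = (\<Sum>k<M. of_real (x k) * fourier_node M i ^ k) / of_nat M"
proof -
  have "exp (\<i> * of_real (2 * pi * real k * real i / real M)) = fourier_node M i ^ k" for k
    unfolding fourier_node_def DeMoivre by (simp add: cis_conv_exp mult_ac)
  then show ?thesis
    by (simp add: fourier_coeff_def)
qed

section \<open>Reduction of prediction to equations at the nodes\<close>

definition complex_prediction :: "nat \<Rightarrow> (nat \<Rightarrow> real) \<Rightarrow> nat \<Rightarrow> (nat \<Rightarrow> complex) \<Rightarrow> bool" where
  "complex_prediction M x L c \<longleftrightarrow>
     (\<forall>k<M. of_real (x ((k + 1) mod M)) =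
       (\<Sum>l\<le>L. c l * of_real (x (nat ((int k - int l) mod int M)))))"

lemma perfect_prediction_iff_complex:
  "perfect_prediction M x L K \<longleftrightarrow> complex_prediction M x L (\<lambda>l. of_real (K $ l))"
  unfolding perfect_prediction_def complex_prediction_def atLeast0AtMost
  by (simp only: of_real_mult[symmetric] of_real_sum[symmetric] of_real_eq_iff)

text \<open>The samples are real scalars, so \<open>Re\<close> passes through the sum. This turns a
  solution built over the complex numbers into real gains.\<close>

lemma perfect_prediction_Re:
  assumes "complex_prediction M x L c"
  shows "perfect_prediction M x L (vec (L + 1) (\<lambda>l. Re (c l)))"
  unfolding perfect_prediction_def
proof (intro allI impI)
  fix k
  assume "k < M"
  then have "x ((k + 1) mod M) = Re (\<Sum>l\<le>L. c l * of_real (x (nat ((int k - int l) mod int M))))"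
    using assms unfolding complex_prediction_def by (metis Re_complex_of_real)
  also have "\<dots> = (\<Sum>l=0..L. vec (L + 1) (\<lambda>l. Re (c l)) $ l * x (nat ((int k - int l) mod int M)))"
    by (simp add: atLeast0AtMost)
  finally show "x ((k + 1) mod M) =
      (\<Sum>l=0..L. vec (L + 1) (\<lambda>l. Re (c l)) $ l * x (nat ((int k - int l) mod int M)))" .
qed

lemma complex_prediction_iff_roots:
  assumes "M > 0"
  shows "complex_prediction M x L c \<longleftrightarrow>
    (\<forall>w \<in> fourier_node M ` fourier_support M x. (\<Sum>l\<le>L. c l * w ^ Suc l) = 1)"
proof -
  define e :: "nat \<Rightarrow> complex" where
    "e k = of_real (x ((k + 1) mod M))
      - (\<Sum>l\<le>L. c l * of_real (x (nat ((int k - int l) mod int M))))" for k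
  \<comment> \<open>The factor \<open>w\<close> clears the \<open>1 / w\<close> that comes from the
    advance by one sample.\<close>
  have transform: "(\<Sum>k<M. e k * w ^ k) * w =
      (1 - (\<Sum>l\<le>L. c l * w ^ Suc l)) * (of_nat M * fourier_coeff M x i)"
    if w: "w = fourier_node M i" for w i
  proof -
    let ?X = "\<Sum>k<M. of_real (x k) * w ^ k"
    have shift: "(\<Sum>k<M. of_real (x (nat ((int k + s) mod int M))) * w ^ k) = w powi (- s) * ?X" for s
      using sum_cyclic_shift[of w M "\<lambda>k. of_real (x k)" s] fourier_node_power_order[OF assms] assms w
      by simp
    have "w \<noteq> 0"
      using w by simp
    have "nat ((int k + 1) mod int M) = (k + 1) mod M" for k
      by (metis nat_int of_nat_1 of_nat_add zmod_int)
    then have "(\<Sum>k<M. of_real (x ((k + 1) mod M)) * w ^ k) = ?X / w"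
      using shift[of 1] by (simp add: power_int_minus divide_inverse mult.commute del: of_nat_Suc)
    moreover have "(\<Sum>k<M. (\<Sum>l\<le>L. c l * of_real (x (nat ((int k - int l) mod int M)))) * w ^ k)
        = (\<Sum>l\<le>L. c l * w ^ l) * ?X"
    proof -
      have "(\<Sum>k<M. (\<Sum>l\<le>L. c l * of_real (x (nat ((int k - int l) mod int M)))) * w ^ k)
          = (\<Sum>l\<le>L. c l * (\<Sum>k<M. of_real (x (nat ((int k + - int l) mod int M))) * w ^ k))"
        by (simp add: sum_distrib_right sum_distrib_left mult.assoc) (rule sum.swap)
      also have "\<dots> = (\<Sum>l\<le>L. c l * w ^ l) * ?X"
        unfolding shift sum_distrib_right by (simp add: mult.assoc)
      finally show ?thesis .
    qed
    ultimately have "(\<Sum>k<M. e k * w ^ k) = ?X / w - (\<Sum>l\<le>L. c l * w ^ l) * ?X"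
      by (simp add: e_def left_diff_distrib sum_subtractf)
    then have "(\<Sum>k<M. e k * w ^ k) * w = ?X - (\<Sum>l\<le>L. c l * w ^ l) * w * ?X"
      using \<open>w \<noteq> 0\<close> by (simp add: field_simps)
    also have "(\<Sum>l\<le>L. c l * w ^ l) * w = (\<Sum>l\<le>L. c l * w ^ Suc l)"
      by (simp add: sum_distrib_left sum_distrib_right mult_ac)
    also have "?X = of_nat M * fourier_coeff M x i"
      using assms w by (simp add: fourier_coeff_eq)
    finally show ?thesis
      by (simp add: left_diff_distrib)
  qed
  have "complex_prediction M x L c \<longleftrightarrow> (\<forall>k<M. e k = 0)"
    by (simp add: complex_prediction_def e_def)
  also have "\<dots> \<longleftrightarrow> (\<forall>i<M. (\<Sum>k<M. e k * fourier_node M i ^ k) = 0)"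
  proof
    \<comment> \<open>The transform is injective: a polynomial with \<open>M\<close> coefficients
      that vanishes at \<open>M\<close> distinct nodes is zero.\<close>
    assume vanish: "\<forall>i<M. (\<Sum>k<M. e k * fourier_node M i ^ k) = 0"
    have "card (fourier_node M ` {..<M}) = M"
      by (simp add: card_image inj_on_fourier_node)
    then show "\<forall>k<M. e k = 0"
      using vanish poly_sum_monom_eq_0_if_many_roots[where A = "fourier_node M ` {..<M}" and n = M and c = e] by auto
  qed simp
  also have "\<dots> \<longleftrightarrow>
      (\<forall>i<M. (\<Sum>l\<le>L. c l * fourier_node M i ^ Suc l) = 1 \<or> fourier_coeff M x i = 0)"
  proof -
    have "(\<Sum>k<M. e k * fourier_node M i ^ k) = 0 \<longleftrightarrow>
        (\<Sum>l\<le>L. c l * fourier_node M i ^ Suc l) = 1 \<or> fourier_coeff M x i = 0" for i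
    proof -
      let ?w = "fourier_node M i"
      have "(\<Sum>k<M. e k * ?w ^ k) = 0 \<longleftrightarrow> (\<Sum>k<M. e k * ?w ^ k) * ?w = 0"
        by simp
      also have "\<dots> \<longleftrightarrow> 1 - (\<Sum>l\<le>L. c l * ?w ^ Suc l) = 0 \<or> fourier_coeff M x i = 0"
        unfolding transform[OF refl] using assms by (simp del: power_Suc)
      finally show ?thesis
        by (simp only: right_minus_eq eq_commute[of 1])
    qed
    then show ?thesis
      by blast
  qed
  also have "\<dots> \<longleftrightarrow> (\<forall>w \<in> fourier_node M ` fourier_support M x. (\<Sum>l\<le>L. c l * w ^ Suc l) = 1)"
    by (auto simp: fourier_support_def)
  finally show ?thesis .
qed

section \<open>Solvability and uniqueness for the equations at given points\<close>

lemma card_le_if_sum_eq_1: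
  fixes c :: "nat \<Rightarrow> 'a::{comm_ring_1,ring_no_zero_divisors}"
  assumes "\<And>w. w \<in> A \<Longrightarrow> (\<Sum>l\<le>L. c l * w ^ Suc l) = 1"
  shows "card A \<le> L + 1"
proof (rule ccontr)
  assume large: "\<not> card A \<le> L + 1"
  \<comment> \<open>The \<open>L + 2\<close> coefficients of
    \<open>1 - (\<Sum>l\<le>L. c l * Z ^ Suc l)\<close>. More than \<open>L + 1\<close> roots would
    make all of them zero, even the constant one, which is \<open>1\<close>.\<close>
  define d where "d = (\<lambda>k. case k of 0 \<Rightarrow> 1 | Suc l \<Rightarrow> - c l)"
  have "(\<Sum>k<L + 2. d k * w ^ k) = 0" if "w \<in> A" for w
  proof -
    have "(\<Sum>k<L + 2. d k * w ^ k) = 1 - (\<Sum>l\<le>L. c l * w ^ Suc l)"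
      unfolding add_2_eq_Suc' lessThan_Suc_atMost sum.atMost_Suc_shift
      by (simp add: d_def sum_negf)
    then show ?thesis
      using assms[OF that] by simp
  qed
  then have "d 0 = 0"
    by (rule poly_sum_monom_eq_0_if_many_roots[where A = A and n = "L + 2"]) (use large in auto)
  then show False
    by (simp add: d_def)
qed

lemma exists_sum_eq_1:
  fixes A :: "'a::field set"
  assumes "finite A" and "0 \<notin> A" and "card A = Suc L"
  shows "\<exists>c. \<forall>w \<in> A. (\<Sum>l\<le>L. c l * w ^ Suc l) = 1"
proof -
  \<comment> \<open>Each factor has constant term \<open>1\<close>, hence so has \<open>R\<close>;
    thus \<open>1 - R\<close> has no constant term, and its remaining coefficients are the desired
    \<open>c\<close>.\<close>
  define R where "R = (\<Prod>w\<in>A. [:1, - inverse w:])"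
  have "degree R \<le> (\<Sum>w\<in>A. degree [:1, - inverse w:])"
    unfolding R_def using degree_prod_sum_le[OF assms(1), of "\<lambda>w. [:1, - inverse w:]"] unfolding o_def .
  also have "\<dots> \<le> (\<Sum>w\<in>A. 1)"
    by (intro sum_mono) simp
  also have "\<dots> = Suc L"
    using assms(3) by simp
  finally have degree: "degree R \<le> Suc L" .
  have "coeff R 0 = 1"
    by (simp add: R_def poly_0_coeff_0[symmetric] poly_prod)
  moreover have "poly R w = (\<Sum>k\<le>Suc L. coeff R k * w ^ k)" for w
    by (subst poly_as_sum_of_monoms'[OF degree, symmetric]) (simp add: poly_sum poly_monom)
  ultimately have "(\<Sum>l\<le>L. - coeff R (Suc l) * w ^ Suc l) = 1 - poly R w" for w
    by (simp add: sum.atMost_Suc_shift sum_negf del: sum.atMost_Suc)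
  moreover have "poly R w = 0" if "w \<in> A" for w
  proof -
    \<comment> \<open>As \<open>inverse 0 = 0\<close>, the factor for \<open>w = 0\<close> would be
      the constant \<open>1\<close>; \<open>0 \<notin> A\<close> excludes this.\<close>
    have "poly [:1, - inverse w:] w = 0"
      using that assms(2) by (cases "w = 0") auto
    then show ?thesis
      unfolding R_def poly_prod using that assms(1) by (intro prod_zero) auto
  qed
  ultimately show ?thesis
    by (intro exI[of _ "\<lambda>l. - coeff R (Suc l)"]) simp
qed

text \<open>The difference of the two equations has no constant term. Dividing it by
  \<open>w\<close> leaves a polynomial of degree at most \<open>L\<close> with more than
  \<open>L\<close> roots.\<close>

lemma sum_eq_1_unique:
  fixes c d :: "nat \<Rightarrow> 'a::field"
  assumes "\<And>w. w \<in> A \<Longrightarrow> (\<Sum>l\<le>L. c l * w ^ Suc l) = 1"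
    and "\<And>w. w \<in> A \<Longrightarrow> (\<Sum>l\<le>L. d l * w ^ Suc l) = 1"
    and "0 \<notin> A" and "L < card A" and "l \<le> L"
  shows "c l = d l"
proof -
  have "(\<Sum>l<Suc L. (c l - d l) * w ^ l) = 0" if "w \<in> A" for w
  proof -
    have "w * (\<Sum>l\<le>L. (c l - d l) * w ^ l)
        = (\<Sum>l\<le>L. c l * w ^ Suc l) - (\<Sum>l\<le>L. d l * w ^ Suc l)"
      by (simp add: sum_distrib_left sum_subtractf[symmetric] algebra_simps)
    then show ?thesis
      using assms(1)[OF that] assms(2)[OF that] assms(3) that
      by (auto simp: lessThan_Suc_atMost simp del: sum.lessThan_Suc)
  qed
  then have "c l - d l = 0"
    by (rule poly_sum_monom_eq_0_if_many_roots[where A = A and n = "Suc L"]) (use assms(4,5) in auto)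
  then show ?thesis
    by simp
qed

theorem theorem1:
  fixes M P :: nat and x :: "nat \<Rightarrow> real"
  assumes "M \<ge> 1"
    and "card {i. i < M \<and> fourier_coeff M x i \<noteq> 0} = P"
    and "P \<ge> 1"
  shows "(\<exists>K \<in> carrier_vec (P - 1 + 1). perfect_prediction M x (P - 1) K)
    \<and> (\<forall>L. (\<exists>K \<in> carrier_vec (L + 1). perfect_prediction M x L K) \<longrightarrow> P - 1 \<le> L)
    \<and> (\<exists>!K. K \<in> carrier_vec (P - 1 + 1) \<and> perfect_prediction M x (P - 1) K)"
proof -
  define A where "A = fourier_node M ` fourier_support M x"
  have "M > 0"
    using assms(1) by simp
  have support: "fourier_support M x \<subseteq> {..<M}" "card (fourier_support M x) = P"
    using assms(2) by (auto simp: fourier_support_def)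
  have "finite A"
    using finite_subset[OF support(1)] by (simp add: A_def)
  have "card A = P"
    using support inj_on_subset[OF inj_on_fourier_node] by (simp add: A_def card_image)
  have "0 \<notin> A"
    by (auto simp: A_def dest: sym)
  \<comment> \<open>From here on the samples enter only through the \<open>P\<close> distinct
    non-zero points of \<open>A\<close>.\<close>
  note roots = complex_prediction_iff_roots[OF \<open>M > 0\<close>, of x, folded A_def]
  have ex: "\<exists>K \<in> carrier_vec (P - 1 + 1). perfect_prediction M x (P - 1) K"
  proof -
    obtain c where "\<forall>w \<in> A. (\<Sum>l\<le>P - 1. c l * w ^ Suc l) = 1"
      using exists_sum_eq_1[OF \<open>finite A\<close> \<open>0 \<notin> A\<close>, of "P - 1"] \<open>card A = P\<close> assms(3) by auto
    then have "perfect_prediction M x (P - 1) (vec (P - 1 + 1) (\<lambda>l. Re (c l)))"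
      by (intro perfect_prediction_Re) (simp only: roots)
    then show ?thesis
      by (rule bexI) (rule vec_carrier)
  qed
  moreover have "P - 1 \<le> L" if "perfect_prediction M x L K" for L K
    using card_le_if_sum_eq_1[where A = A and L = L] that \<open>card A = P\<close>
    unfolding perfect_prediction_iff_complex roots by fastforce
  moreover have "K = K'"
    if "K \<in> carrier_vec (P - 1 + 1)" "perfect_prediction M x (P - 1) K"
      "K' \<in> carrier_vec (P - 1 + 1)" "perfect_prediction M x (P - 1) K'" for K K'
  \<comment> \<open>Both vectors have dimension \<open>P - 1 + 1\<close>, so the entries to compare
    are those with \<open>l \<le> P - 1\<close>; \<open>P \<ge> 1\<close> gives
    \<open>P - 1 < card A\<close>.\<close>
  proof (rule eq_vecI)
    fix l
    assume "l < dim_vec K'"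
    then have "complex_of_real (K $ l) = complex_of_real (K' $ l)"
      using that \<open>0 \<notin> A\<close> \<open>card A = P\<close> assms(3)
      unfolding perfect_prediction_iff_complex roots
      by (intro sum_eq_1_unique[where A = A and L = "P - 1" and c = "\<lambda>l. of_real (K $ l)"
          and d = "\<lambda>l. of_real (K' $ l)"]) auto
    then show "K $ l = K' $ l"
      by simp
  qed (use that in auto)
  ultimately show ?thesis
    by blast
qed

end
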